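(* Let $V$ be a vacuum-free vertex algebra and let $W$ be a vector space equipped with a linear map $Y_W(\cdot,x):V\to(\mathrm{End}\,W)[[x,x^{-1}]]$, $v\mapsto Y_W(v,x)=\sum_{n\in\mathbb Z}v_nx^{-n-1}$, such that $Y_W(u,x)w\in W((x))$ for all $u\in V$, $w\in W$. Consider the properties: (WC, weak commutativity) for all $u,v\in V$ there exists an integer $m\ge0$ such that $(x_1-x_2)^{m}\left(Y_W(u,x_1)Y_W(v,x_2)-Y_W(v,x_2)Y_W(u,x_1)\right)=0$; (WA, weak associativity) for all $u,v\in V$, $w\in W$ there exists an integer $m\ge0$ such that $(x_0+x_2)^{m}\left(Y_W(u,x_0+x_2)Y_W(v,x_2)w-Y_W(Y(u,x_0)v,x_2)w\right)=0$; (WSA, weak skew-associativity) for all $u,v\in V$, $w\in W$ there exists an integer $m\ge0$ such that $(x_1-x_0)^{m}\left(Y_W(v,-x_0+x_1)Y_W(u,x_1)w-Y_W(Y(u,x_0)v,x_1-x_0)w\right)=0$. Then any two of (WC), (WA), (WSA) can replace the Jacobi identity in the definition of module for a vacuum-free vertex algebra; that is, for each choice of two of these three properties, the two chosen properties both hold if and only if the Jacobi identity holds: for all $u,v\in V$, $w\in W$, $$x_0^{-1}\delta\left(\frac{x_1-x_2}{x_0}\right)Y_W(u,x_1)Y_W(v,x_2)w-x_0^{-1}\delta\left(\frac{-x_2+x_1}{x_0}\right)Y_W(v,x_2)Y_W(u,x_1)w=x_1^{-1}\delta\left(\frac{x_2+x_0}{x_1}\right)Y_W(Y(u,x_0)v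,x_2)w.$$
   Context: All vector spaces are over $\mathbb C$; formal variables commute. For a vector space $U$, $U[[x,x^{-1}]]$ is the space of all formal Laurent series $\sum_{n\in\mathbb Z}u_nx^n$ with $u_n\in U$; $U((x))$ is the subspace of series with $u_n=0$ for $n$ sufficiently negative. $\delta(x)=\sum_{n\in\mathbb Z}x^n$. Binomial expansion convention: for every $n\in\mathbb Z$, $(x+y)^n=\sum_{k\ge0}\binom nk x^{n-k}y^k$, i.e. binomials are expanded in nonnegative powers of the second-listed variable (likewise with signs, so $(x_1-x_2)^n$ is expanded in nonnegative powers of $x_2$ and $(-x_2+x_1)^n$ in nonnegative powers of $x_1$); this applies inside $\delta$ and to substitutions such as $F(x+y)$. Vertex operator maps are extended coefficientwise to series: $Y_W(Y(u,x_0)v,x_2)=\sum_n Y_W(u_nv,x_2)x_0^{-n-1}$. A vacuum-free vertex algebra is a vector space $V$ with an injective linear map $Y(\cdot,x):V\to(\mathrm{End}\,V)[[x,x^{-1}]]$, $v\mapsto Y(v,x)=\sum_{n\in\mathbb Z}v_nx^{-n-1}$, such that $Y(u,x)v\in V((x))$ for all $u,v\in V$ and the Jacobi identity holds for all $u,v\in V$: $$x_0^{-1}\delta\left(\tfrac{x_1-x_2}{x_0}\right)Y(u,x_1)Y(v,x_2)-x_0^{-1}\delta\left(\tfrac{-x_2+x_1}{x_0}\right)Y(v,x_2)Y(u,x_1)=x_1^{-1}\delta\left(\tfrac{x_2+x_0}{x_1}\right)Y(Y(u,x_0)v,x_2).$$ A module for a vacuum-free vertex algebra $V$ is a vector space $W$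 with a linear map $Y_W(\cdot,x):V\to(\mathrm{End}\,W)[[x,x^{-1}]]$ such that $Y_W(u,x)w\in W((x))$ for all $u\in V$, $w\in W$ and the module Jacobi identity (displayed in the claim) holds. *)

theory Defs
  imports Complex_Main "HOL-Library.Product_Plus" "HOL-Library.Groups_Big_Fun"
begin

text \<open>
  A formal Laurent series in finitely many variables is the function taking an exponent vector
  (a tuple of integers) to the coefficient of that monomial.  A vertex operator map is given by its
  modes: \<open>Y v n\<close> is \<open>v\<^sub>n\<close>, so the coefficient of \<open>x\<close> to the power \<open>a\<close> in \<open>Y(v,x)\<close>
  is \<open>Y v (- a - 1)\<close>.  Identities of operator-valued series are read after application to a vector,
  which is where the coefficient sums are finite.
\<close>

text \<open>
  Coefficient of \<open>x\<close> to the \<open>i\<close> times \<open>y\<close> to the \<open>j\<close> in the \<open>n\<close>-th power of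
  \<open>\<alpha> x + \<beta> y\<close> for nonzero \<open>\<alpha>, \<beta>\<close>, expanded in nonnegative powers of the second-listed
  variable \<open>y\<close>.
\<close>

definition binom_power :: "complex \<Rightarrow> complex \<Rightarrow> int \<Rightarrow> int \<times> int \<Rightarrow> complex" where
  "binom_power \<alpha> \<beta> n = (\<lambda>(i, j).
     if 0 \<le> j \<and> i + j = n
     then (of_int n gchoose nat j) * \<alpha> powi i * \<beta> powi j else 0)"

text \<open>
  The series \<open>1/z \<delta>((\<alpha> x + \<beta> y)/z)\<close>, i.e. the sum over all integers \<open>n\<close> of \<open>z\<close> to the
  \<open>- n - 1\<close> times the \<open>n\<close>-th power of \<open>\<alpha> x + \<beta> y\<close>; exponents are listed in the order
  \<open>(z, x, y)\<close>.
\<close>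

definition delta_quot :: "complex \<Rightarrow> complex \<Rightarrow> int \<times> int \<times> int \<Rightarrow> complex" where
  "delta_quot \<alpha> \<beta> = (\<lambda>(a, i, j). binom_power \<alpha> \<beta> (- a - 1) (i, j))"

text \<open>
  Pitfall: \<^const>\<open>Sum_any\<close> is the sum over the support, and is \<open>0\<close> by convention if the support
  is infinite.  In all uses below the support is finite, by the truncation condition or because one
  factor is a Laurent polynomial.
\<close>

definition series_mult ::
  "(complex \<Rightarrow> 'u \<Rightarrow> 'u) \<Rightarrow> ('e::ab_group_add \<Rightarrow> complex) \<Rightarrow> ('e \<Rightarrow> 'u) \<Rightarrow> 'e \<Rightarrow> 'u::ab_group_add"
  where "series_mult scale f F e = Sum_any (\<lambda>d. scale (f d) (F (e - d)))"

text \<open>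
  For \<open>F(z, y)\<close>, the series \<open>F(\<alpha> x + \<beta> y, y)\<close> in \<open>(x, y)\<close>.
\<close>

definition series_subst ::
  "(complex \<Rightarrow> 'u \<Rightarrow> 'u) \<Rightarrow> complex \<Rightarrow> complex \<Rightarrow> (int \<times> int \<Rightarrow> 'u) \<Rightarrow> int \<times> int \<Rightarrow> 'u::ab_group_add"
  where
  "series_subst scale \<alpha> \<beta> F = (\<lambda>(i, j).
     Sum_any (\<lambda>(p, q). scale (binom_power \<alpha> \<beta> p (i, j - q)) (F (p, q))))"

text \<open>\<open>Y\<^sub>W(u,x) Y\<^sub>W(v,y) w\<close> as a series in \<open>(x, y)\<close>.\<close>

definition vo_product ::
  "('v \<Rightarrow> int \<Rightarrow> 'w \<Rightarrow> 'w) \<Rightarrow> 'v \<Rightarrow> 'v \<Rightarrow> 'w \<Rightarrow> int \<times> int \<Rightarrow> 'w" where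
  "vo_product YW u v w = (\<lambda>(a, b). YW u (- a - 1) (YW v (- b - 1) w))"

text \<open>\<open>Y\<^sub>W(Y(u,x) v, y) w\<close> as a series in \<open>(x, y)\<close>.\<close>

definition vo_iterate ::
  "('v \<Rightarrow> int \<Rightarrow> 'v \<Rightarrow> 'v) \<Rightarrow> ('v \<Rightarrow> int \<Rightarrow> 'w \<Rightarrow> 'w) \<Rightarrow> 'v \<Rightarrow> 'v \<Rightarrow> 'w \<Rightarrow> int \<times> int \<Rightarrow> 'w" where
  "vo_iterate Y YW u v w = (\<lambda>(a, b). YW (Y u (- a - 1) v) (- b - 1) w)"

text \<open>
  All three terms are series in \<open>(x\<^sub>0, x\<^sub>1, x\<^sub>2)\<close>; a series not involving one of these variables
  is supported where the exponent of that variable is \<open>0\<close>.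
\<close>

definition jacobi_identity ::
  "(complex \<Rightarrow> 'w \<Rightarrow> 'w) \<Rightarrow> ('v \<Rightarrow> int \<Rightarrow> 'v \<Rightarrow> 'v) \<Rightarrow> ('v \<Rightarrow> int \<Rightarrow> 'w \<Rightarrow> 'w::ab_group_add) \<Rightarrow> bool" where
  "jacobi_identity scale Y YW \<longleftrightarrow> (\<forall>u v w. \<forall>e :: int \<times> int \<times> int.
     series_mult scale
       (\<lambda>(a0, a1, a2). delta_quot 1 (- 1) (a0, a1, a2))
       (\<lambda>(a0, a1, a2). if a0 = 0 then vo_product YW u v w (a1, a2) else 0) e
     - series_mult scale
       (\<lambda>(a0, a1, a2). delta_quot (- 1) 1 (a0, a2, a1))
       (\<lambda>(a0, a1, a2). if a0 = 0 then vo_product YW v u w (a2, a1) else 0) e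
     = series_mult scale
       (\<lambda>(a0, a1, a2). delta_quot 1 1 (a1, a2, a0))
       (\<lambda>(a0, a1, a2). if a1 = 0 then vo_iterate Y YW u v w (a0, a2) else 0) e)"

text \<open>Series in \<open>(x\<^sub>1, x\<^sub>2)\<close>; \<open>m\<close> does not depend on \<open>w\<close>, the identity being one of operators.\<close>

definition weak_commutativity ::
  "(complex \<Rightarrow> 'w \<Rightarrow> 'w) \<Rightarrow> ('v \<Rightarrow> int \<Rightarrow> 'w \<Rightarrow> 'w::ab_group_add) \<Rightarrow> bool" where
  "weak_commutativity scale YW \<longleftrightarrow> (\<forall>u v. \<exists>m::nat. \<forall>w e.
     series_mult scale (binom_power 1 (- 1) (int m))
       (\<lambda>(a1, a2). vo_product YW u v w (a1, a2) - vo_product YW v u w (a2, a1)) e = 0)"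

text \<open>Series in \<open>(x\<^sub>0, x\<^sub>2)\<close>.\<close>

definition weak_associativity ::
  "(complex \<Rightarrow> 'w \<Rightarrow> 'w) \<Rightarrow> ('v \<Rightarrow> int \<Rightarrow> 'v \<Rightarrow> 'v) \<Rightarrow> ('v \<Rightarrow> int \<Rightarrow> 'w \<Rightarrow> 'w::ab_group_add) \<Rightarrow> bool" where
  "weak_associativity scale Y YW \<longleftrightarrow> (\<forall>u v w. \<exists>m::nat. \<forall>e.
     series_mult scale (binom_power 1 1 (int m))
       (\<lambda>(a0, a2). series_subst scale 1 1 (vo_product YW u v w) (a0, a2)
                 - vo_iterate Y YW u v w (a0, a2)) e = 0)"

text \<open>
  Series in \<open>(x\<^sub>1, x\<^sub>0)\<close>.  The first substitution is \<open>- x\<^sub>0 + x\<^sub>1\<close>, giving a series in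
  \<open>(x\<^sub>0, x\<^sub>1)\<close>; the second is \<open>x\<^sub>1 - x\<^sub>0\<close> for the second variable of the iterate, giving a
  series in \<open>(x\<^sub>1, x\<^sub>0)\<close>.
\<close>

definition weak_skew_associativity ::
  "(complex \<Rightarrow> 'w \<Rightarrow> 'w) \<Rightarrow> ('v \<Rightarrow> int \<Rightarrow> 'v \<Rightarrow> 'v) \<Rightarrow> ('v \<Rightarrow> int \<Rightarrow> 'w \<Rightarrow> 'w::ab_group_add) \<Rightarrow> bool" where
  "weak_skew_associativity scale Y YW \<longleftrightarrow> (\<forall>u v w. \<exists>m::nat. \<forall>e.
     series_mult scale (binom_power 1 (- 1) (int m))
       (\<lambda>(a1, a0). series_subst scale (- 1) 1 (vo_product YW v u w) (a0, a1)
                 - series_subst scale 1 (- 1)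
                     (\<lambda>(p, a). vo_iterate Y YW u v w (a, p)) (a1, a0)) e = 0)"

text \<open>
  A linear map \<open>v \<mapsto> Y(v,x)\<close> from \<open>V\<close> to series with coefficients in \<open>End W\<close>, satisfying the
  truncation condition.
\<close>

locale vertex_operator_map =
  V: vector_space scaleV + W: vector_space scaleW
  for scaleV :: "complex \<Rightarrow> 'v \<Rightarrow> 'v::ab_group_add"
  and scaleW :: "complex \<Rightarrow> 'w \<Rightarrow> 'w::ab_group_add" +
  fixes Y :: "'v \<Rightarrow> int \<Rightarrow> 'w \<Rightarrow> 'w"
  assumes linear_map: "Vector_Spaces.linear scaleV scaleW (\<lambda>v. Y v n w)"
      and linear_mode: "Vector_Spaces.linear scaleW scaleW (Y v n)"
      and truncation: "\<exists>N. \<forall>n\<ge>N. Y v n w = 0"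

locale vacuum_free_vertex_algebra =
  vertex_operator_map scaleV scaleV Y
  for scaleV :: "complex \<Rightarrow> 'v \<Rightarrow> 'v::ab_group_add"
  and Y :: "'v \<Rightarrow> int \<Rightarrow> 'v \<Rightarrow> 'v" +
  assumes inj_Y: "inj Y"
      and jacobi: "jacobi_identity scaleV Y Y"

end

theory Submission
  imports Defs
begin

text \<open>
  Fix \<open>u\<close>, \<open>v\<close>, \<open>w\<close>.  The coefficient of \<open>x\<^sub>0\<close> to the \<open>- l - 1\<close>, \<open>x\<^sub>1\<close> to the \<open>- m - 1\<close>,
  \<open>x\<^sub>2\<close> to the \<open>- n - 1\<close> in the Jacobi identity is Borcherds' identity: a sum \<open>A\<close> of products
  \<open>u\<^sub>a v\<^sub>b w\<close>, minus a sum \<open>B\<close> of opposite products \<open>v\<^sub>b u\<^sub>a w\<close>, equals a sum \<open>C\<close> of iterates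
  \<open>(u\<^sub>a v)\<^sub>b w\<close>.  Put \<open>J = A - B - C\<close>.

  Two facts about these functions of \<open>(l, m, n)\<close> give everything.  Pascal's rule shows that each of
  them satisfies \<open>F(l, m + 1, n) = F(l + 1, m, n) + F(l, m, n + 1)\<close>, which is the relation
  \<open>x\<^sub>1 = x\<^sub>0 + x\<^sub>2\<close> imposed by the delta functions.  The truncation condition makes \<open>C\<close> vanish for
  large \<open>l\<close>, \<open>B\<close> for large \<open>m\<close> and \<open>A\<close> for large \<open>n\<close>.

  The three weak properties say that two of the three terms cancel on a slice.  At \<open>l = 0\<close> the
  difference \<open>A - B\<close> is the commutator, and multiplying it by \<open>x\<^sub>1 - x\<^sub>2\<close> raises \<open>l\<close> by one, so weak
  commutativity says that \<open>A - B\<close> vanishes for some \<open>l \<ge> 0\<close>.  By the recurrence it then vanishes for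
  all larger \<open>l\<close>, and so does \<open>J\<close>.  In the same way weak associativity says that \<open>J\<close> vanishes for
  large \<open>m\<close>, and weak skew-associativity that \<open>J\<close> vanishes for large \<open>n\<close>
  (\<open>weak_commutativity_iff_defect\<close> and its two companions).

  If \<open>J\<close> vanishes for large values of two of its indices, the recurrence, solved for the term in
  which neither of these two indices is raised, lets one descend to arbitrary values of both
  (\<open>three_term_vanishes\<close>).  So any two of the properties force \<open>J = 0\<close>.  In the other direction only
  the uniformity in \<open>w\<close> of weak commutativity needs care, and it holds because the
  bound on \<open>l\<close> comes from \<open>u\<^sub>l v = 0\<close>, where \<open>w\<close> does not occur.
\<close>

section \<open>Binomial sums\<close>

text \<open>
  All the series in question have coefficients of this shape.
\<close>

definition binom_sum :: "(complex \<Rightarrow> 'u \<Rightarrow> 'u) \<Rightarrow> int \<Rightarrow> (nat \<Rightarrow> 'u) \<Rightarrow> 'u::ab_group_add" where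
  "binom_sum scale n F = Sum_any (\<lambda>k. scale (of_int n gchoose k) (F k))"

lemma Sum_any_reindex_inj:
  assumes "inj h" and "\<And>x. x \<notin> range h \<Longrightarrow> g x = 0"
  shows "Sum_any g = Sum_any (\<lambda>k. g (h k))"
proof -
  have "{x. g x \<noteq> 0} = h ` {k. g (h k) \<noteq> 0}"
  proof (intro set_eqI iffI)
    fix x assume "x \<in> {x. g x \<noteq> 0}"
    with assms(2)[of x] show "x \<in> h ` {k. g (h k) \<noteq> 0}"
      by (cases "x \<in> range h") auto
  qed auto
  moreover have "sum g (h ` {k. g (h k) \<noteq> 0}) = (\<Sum>k\<in>{k. g (h k) \<noteq> 0}. g (h k))"
    using assms(1) by (subst sum.reindex) (auto intro: inj_on_subset)
  ultimately show ?thesis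
    by (simp add: Sum_any.expand_set)
qed

lemma Sum_any_eq_sum_lessThan:
  fixes g :: "nat \<Rightarrow> 'u::ab_group_add"
  assumes "\<And>k. N \<le> k \<Longrightarrow> g k = 0"
  shows "Sum_any g = (\<Sum>k<N. g k)"
  using assms by (intro Sum_any.expand_superset) (auto simp: not_less[symmetric])

text \<open>
  Pascal's rule, summed.  Either finiteness hypothesis makes all the sums finite; the first covers
  multiplication of an arbitrary series by a Laurent polynomial (\<open>n \<ge> 0\<close>), the second a truncated
  series with \<open>n\<close> of either sign.
\<close>

lemma binom_sum_plus_one:
  assumes "vector_space scale"
    and fin: "(\<forall>k\<ge>N. (of_int n :: complex) gchoose k = 0) \<or> (\<forall>k\<ge>N. F k = 0)"
  shows "binom_sum scale (n + 1) F = binom_sum scale n F + binom_sum scale n (\<lambda>k. F (Suc k))"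
proof -
  interpret vector_space scale by fact
  let ?g = "\<lambda>n k. of_int n gchoose k :: complex"
  have pascal: "?g (n + 1) (Suc k) = ?g n k + ?g n (Suc k)" for k
    by (simp add: gbinomial_Suc_Suc)
  have vanish: "?g (n + 1) (Suc k) = 0 \<or> F (Suc k) = 0"
    "?g n k = 0 \<or> F k = 0" "?g n k = 0 \<or> F (Suc k) = 0" if "N \<le> k" for k
    using fin that pascal[of k] by auto
  have "binom_sum scale (n + 1) F = (\<Sum>k<Suc N. scale (?g (n + 1) k) (F k))"
    unfolding binom_sum_def
  proof (rule Sum_any_eq_sum_lessThan)
    show "scale (?g (n + 1) k) (F k) = 0" if "Suc N \<le> k" for k
      using that vanish(1)[of "k - 1"] by auto
  qed
  also have "\<dots> = F 0 + (\<Sum>k<N. scale (?g n k) (F (Suc k))) + (\<Sum>k<N. scale (?g n (Suc k)) (F (Suc k)))"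
    by (simp only: sum.lessThan_Suc_shift pascal scale_left_distrib sum.distrib) simp
  also have "F 0 + (\<Sum>k<N. scale (?g n k) (F (Suc k))) + (\<Sum>k<N. scale (?g n (Suc k)) (F (Suc k)))
     = (\<Sum>k<Suc N. scale (?g n k) (F k)) + (\<Sum>k<N. scale (?g n k) (F (Suc k)))"
    by (simp only: sum.lessThan_Suc_shift) simp
  also have "(\<Sum>k<Suc N. scale (?g n k) (F k)) = binom_sum scale n F"
    unfolding binom_sum_def
    by (rule Sum_any_eq_sum_lessThan[symmetric]) (use vanish in force)
  also have "(\<Sum>k<N. scale (?g n k) (F (Suc k))) = binom_sum scale n (\<lambda>k. F (Suc k))"
    unfolding binom_sum_def
    by (rule Sum_any_eq_sum_lessThan[symmetric]) (use vanish in force)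
  finally show ?thesis .
qed

lemma binom_sum_scale:
  assumes "vector_space scale" and "c \<noteq> 0"
  shows "binom_sum scale n (\<lambda>k. scale c (F k)) = scale c (binom_sum scale n F)"
proof -
  interpret vector_space scale by fact
  have "{k. scale (of_int n gchoose k) (scale c (F k)) \<noteq> 0} = {k. scale (of_int n gchoose k) (F k) \<noteq> 0}"
    using assms(2) by auto
  then show ?thesis
    unfolding binom_sum_def Sum_any.expand_set
    by (simp add: scale_sum_right mult.commute cong: sum.cong)
qed

lemma binom_sum_eq_0:
  assumes "vector_space scale" and "\<And>k. F k = 0"
  shows "binom_sum scale n F = 0"
proof -
  interpret vector_space scale by fact
  show ?thesis
    by (simp add: binom_sum_def assms(2))
qed

lemma binom_sum_0:
  assumes "vector_space scale"
  shows "binom_sum scale 0 F = F 0"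
proof -
  interpret vector_space scale by fact
  show ?thesis
    unfolding binom_sum_def
    by (subst Sum_any_eq_sum_lessThan[of 1]) (auto simp: gbinomial_0_left)
qed

section \<open>Multiplication by and substitution of binomials\<close>

lemma series_mult_binom_power:
  assumes "vector_space scale"
  shows "series_mult scale (binom_power \<alpha> \<beta> n) F (a, b) =
    binom_sum scale n (\<lambda>k. scale (\<alpha> powi (n - int k) * \<beta> ^ k) (F (a - n + int k, b - int k)))"
proof -
  interpret vector_space scale by fact
  let ?h = "\<lambda>k::nat. (n - int k, int k)"
  have "series_mult scale (binom_power \<alpha> \<beta> n) F (a, b)
      = Sum_any (\<lambda>k. scale (binom_power \<alpha> \<beta> n (?h k)) (F ((a, b) - ?h k)))"
    unfolding series_mult_def
  proof (rule Sum_any_reindex_inj)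
    show "inj ?h"
      by (auto intro: injI)
    show "scale (binom_power \<alpha> \<beta> n x) (F ((a, b) - x)) = 0" if "x \<notin> range ?h" for x
    proof -
      obtain i j where x: "x = (i, j)" by (cases x)
      have "\<not> (0 \<le> j \<and> i + j = n)"
        using that by (auto simp: x image_iff dest: spec[of _ "nat j"])
      then have "binom_power \<alpha> \<beta> n x = 0" by (simp only: x binom_power_def prod.case if_False)
      then show ?thesis by simp
    qed
  qed
  also have "(\<lambda>k. scale (binom_power \<alpha> \<beta> n (?h k)) (F ((a, b) - ?h k)))
      = (\<lambda>k. scale (of_int n gchoose k)
          (scale (\<alpha> powi (n - int k) * \<beta> ^ k) (F (a - n + int k, b - int k))))"
    by (simp add: binom_power_def mult.assoc diff_diff_eq2 add_diff_eq diff_add_eq)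
  finally show ?thesis
    by (simp only: binom_sum_def)
qed

text \<open>
  The power of a binomial acts by iterating multiplication by the binomial itself.  Thus a family
  \<open>H\<close> in which each member is the binomial times its predecessor computes all products with powers,
  and the weak properties can be read off without expanding any power.
\<close>

lemma series_mult_binom_power_iterate:
  assumes "vector_space scale" and nz: "\<alpha> \<noteq> 0" "\<beta> \<noteq> 0"
    and step: "\<And>k a b. H (Suc k) (a, b) = scale \<alpha> (H k (a - 1, b)) + scale \<beta> (H k (a, b - 1))"
  shows "series_mult scale (binom_power \<alpha> \<beta> (int k)) (H 0) = H k"
proof (induction k)
  case 0
  interpret vector_space scale by fact
  show ?case
    by (rule ext) (auto simp: series_mult_binom_power[OF assms(1)] binom_sum_0[OF assms(1)])
next
  case (Suc k)
  interpret vector_space scale by fact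
  let ?F = "\<lambda>c d j. scale (\<alpha> powi (int k - int j) * \<beta> ^ j) (H 0 (c - int k + int j, d - int j))"
  let ?G = "\<lambda>a b j. scale (\<alpha> powi (int (Suc k) - int j) * \<beta> ^ j) (H 0 (a - int (Suc k) + int j, b - int j))"
  have vanish: "\<forall>j\<ge>Suc k. (of_int (int k) :: complex) gchoose j = 0"
    by (simp add: binomial_gbinomial[symmetric])
  have "series_mult scale (binom_power \<alpha> \<beta> (int (Suc k))) (H 0) (a, b) = H (Suc k) (a, b)" for a b
  proof -
    have powi: "\<alpha> powi (int k - int j + 1) = \<alpha> * \<alpha> powi (int k - int j)" for j
      using nz by (simp add: power_int_add)
    have "series_mult scale (binom_power \<alpha> \<beta> (int (Suc k))) (H 0) (a, b)
       = binom_sum scale (int k + 1) (?G a b)"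
      by (subst series_mult_binom_power[OF assms(1)]) (simp add: algebra_simps)
    also have "\<dots> = binom_sum scale (int k) (?G a b) + binom_sum scale (int k) (\<lambda>j. ?G a b (Suc j))"
      using vanish by (intro binom_sum_plus_one[OF assms(1)]) blast
    finally have pascal: "series_mult scale (binom_power \<alpha> \<beta> (int (Suc k))) (H 0) (a, b)
       = binom_sum scale (int k) (?G a b) + binom_sum scale (int k) (\<lambda>j. ?G a b (Suc j))" .
    have fst: "?G a b = (\<lambda>j. scale \<alpha> (?F (a - 1) b j))"
      using powi by (auto simp: algebra_simps)
    have snd: "(\<lambda>j. ?G a b (Suc j)) = (\<lambda>j. scale \<beta> (?F a (b - 1) j))"
      by (auto simp: algebra_simps)
    show ?thesis
      unfolding pascal fst snd step Suc.IH[symmetric]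
      by (simp only: binom_sum_scale[OF assms(1)] nz series_mult_binom_power[OF assms(1)] simp_thms)
  qed
  then show ?case by auto
qed

text \<open>
  Substitution produces coefficients \<open>(a + k) gchoose k\<close>, whose upper index varies with \<open>k\<close>.  Negating
  the upper index turns them, up to sign, into \<open>(- a - 1) gchoose k\<close>, the numbers that
  occur in the Jacobi identity.
\<close>

lemma series_subst_binom_sum:
  assumes "vector_space scale"
  shows "series_subst scale \<alpha> \<beta> F (a, b) =
    binom_sum scale (- a - 1) (\<lambda>k. scale (\<alpha> powi a * (- \<beta>) ^ k) (F (a + int k, b - int k)))"
proof -
  interpret vector_space scale by fact
  let ?h = "\<lambda>k::nat. (a + int k, b - int k)"
  let ?g = "\<lambda>(p, q). scale (binom_power \<alpha> \<beta> p (a, b - q)) (F (p, q))"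
  have "series_subst scale \<alpha> \<beta> F (a, b) = Sum_any ?g"
    by (simp add: series_subst_def)
  also have "\<dots> = Sum_any (\<lambda>k. ?g (?h k))"
  proof (rule Sum_any_reindex_inj)
    show "inj ?h"
      by (auto intro: injI)
    show "?g x = 0" if "x \<notin> range ?h" for x
    proof -
      obtain p q where x: "x = (p, q)" by (cases x)
      have "\<not> (0 \<le> b - q \<and> a + (b - q) = p)"
        using that by (auto simp: x image_iff dest: spec[of _ "nat (b - q)"])
      then have "binom_power \<alpha> \<beta> p (a, b - q) = 0"
        by (simp only: binom_power_def prod.case if_False)
      then show ?thesis by (simp add: x)
    qed
  qed
  also have "(\<lambda>k. ?g (?h k)) = (\<lambda>k. scale (of_int (- a - 1) gchoose k)
      (scale (\<alpha> powi a * (- \<beta>) ^ k) (F (a + int k, b - int k))))"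
  proof
    fix k
    have "(of_int (a + int k) :: complex) gchoose k = (- 1) ^ k * (of_int (- a - 1) gchoose k)"
      by (subst gbinomial_negated_upper) (simp add: algebra_simps)
    then show "?g (?h k) = scale (of_int (- a - 1) gchoose k)
      (scale (\<alpha> powi a * (- \<beta>) ^ k) (F (a + int k, b - int k)))"
      by (simp add: binom_power_def power_minus[of \<beta>] mult_ac)
  qed
  finally show ?thesis
    by (simp add: binom_sum_def)
qed

section \<open>Vanishing by descent\<close>

text \<open>
  Induction on the distance from the region \<open>i \<ge> I\<close> or \<open>j \<ge> J\<close>, measured by the sum of the two deficits:
  both neighbours used in the step are closer to that region.
\<close>

lemma descent_two_directions:
  fixes P :: "int \<Rightarrow> int \<Rightarrow> bool"
  assumes I: "\<And>i j. I \<le> i \<Longrightarrow> P i j" and J: "\<And>i j. J \<le> j \<Longrightarrow> P i j"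
    and step: "\<And>i j. P (i + 1) j \<Longrightarrow> P i (j + 1) \<Longrightarrow> P i j"
  shows "P i j"
proof (induction "nat (I - i) + nat (J - j)" arbitrary: i j rule: less_induct)
  case less
  show ?case
  proof (cases "I \<le> i \<or> J \<le> j")
    case True
    then show ?thesis using I J by blast
  next
    case False
    then have "P (i + 1) j" "P i (j + 1)"
      by (auto intro!: less)
    then show ?thesis by (rule step)
  qed
qed

text \<open>
  The relation \<open>x\<^sub>1 = x\<^sub>0 + x\<^sub>2\<close> on coefficients indexed by modes.
\<close>

definition three_term :: "(int \<Rightarrow> int \<Rightarrow> int \<Rightarrow> 'u::ab_group_add) \<Rightarrow> bool" where
  "three_term J \<longleftrightarrow> (\<forall>l m n. J l (m + 1) n = J (l + 1) m n + J l m (n + 1))"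

lemma three_term_diff:
  "three_term J \<Longrightarrow> three_term K \<Longrightarrow> three_term (\<lambda>l m n. J l m n - K l m n)"
  by (simp add: three_term_def)

lemma three_term_uminus: "three_term J \<Longrightarrow> three_term (\<lambda>l m n. - J l m n)"
  by (simp add: three_term_def)

text \<open>
  For each index, the recurrence can be solved for the term in which that index is raised, so
  vanishing on one slice propagates upwards.
\<close>

lemma three_term_above:
  assumes "three_term J"
  shows "(\<And>m n. J L m n = 0) \<Longrightarrow> L \<le> l \<Longrightarrow> J l m n = 0"
    and "(\<And>l n. J l M n = 0) \<Longrightarrow> M \<le> m \<Longrightarrow> J l m n = 0"
    and "(\<And>l m. J l m N = 0) \<Longrightarrow> N \<le> n \<Longrightarrow> J l m n = 0"
proof -
  have rec: "J l (m + 1) n = J (l + 1) m n + J l m (n + 1)" for l m n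
    using assms by (simp add: three_term_def)
  { assume 0: "\<And>m n. J L m n = 0" and "L \<le> l"
    from \<open>L \<le> l\<close> show "J l m n = 0"
    proof (induction arbitrary: m n rule: int_ge_induct)
      case (step i)
      then show ?case using rec[of i m n] by simp
    qed (use 0 in auto) }
  { assume 0: "\<And>l n. J l M n = 0" and "M \<le> m"
    from \<open>M \<le> m\<close> show "J l m n = 0"
    proof (induction arbitrary: l n rule: int_ge_induct)
      case (step i)
      then show ?case using rec[of l i n] by simp
    qed (use 0 in auto) }
  { assume 0: "\<And>l m. J l m N = 0" and "N \<le> n"
    from \<open>N \<le> n\<close> show "J l m n = 0"
    proof (induction arbitrary: l m rule: int_ge_induct)
      case (step i)
      then show ?case using rec[of l m i] by simp
    qed (use 0 in auto) }
qed

text \<open>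
  In each of the three cases the third index is quantified inside the induction predicate, since solving
  the recurrence for the remaining term may shift it.
\<close>

lemma three_term_vanishes:
  assumes "three_term J"
  shows "\<forall>l m n. L \<le> l \<longrightarrow> J l m n = 0 \<Longrightarrow> \<forall>l m n. M \<le> m \<longrightarrow> J l m n = 0 \<Longrightarrow> J l m n = 0"
    and "\<forall>l m n. L \<le> l \<longrightarrow> J l m n = 0 \<Longrightarrow> \<forall>l m n. N \<le> n \<longrightarrow> J l m n = 0 \<Longrightarrow> J l m n = 0"
    and "\<forall>l m n. M \<le> m \<longrightarrow> J l m n = 0 \<Longrightarrow> \<forall>l m n. N \<le> n \<longrightarrow> J l m n = 0 \<Longrightarrow> J l m n = 0"
proof -
  have rec: "J l (m + 1) n = J (l + 1) m n + J l m (n + 1)" for l m n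
    using assms by (simp add: three_term_def)
  { assume "\<forall>l m n. L \<le> l \<longrightarrow> J l m n = 0" "\<forall>l m n. M \<le> m \<longrightarrow> J l m n = 0"
    note bounds = this
    have "\<forall>n. J l m n = 0"
    proof (rule descent_two_directions[where I = L and J = M and P = "\<lambda>l m. \<forall>n. J l m n = 0"])
      show "\<forall>n. J l m n = 0" if "L \<le> l" for l m
        using bounds(1) that by blast
      show "\<forall>n. J l m n = 0" if "M \<le> m" for l m
        using bounds(2) that by blast
      show "\<forall>n. J l m n = 0" if "\<forall>n. J (l + 1) m n = 0" "\<forall>n. J l (m + 1) n = 0" for l m
      proof
        fix n
        show "J l m n = 0" using that rec[of l m "n - 1"] by simp
      qed
    qed
    then show "J l m n = 0" by blast }
  { assume "\<forall>l m n. L \<le> l \<longrightarrow> J l m n = 0" "\<forall>l m n. N \<le> n \<longrightarrow> J l m n = 0"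
    note bounds = this
    have "\<forall>m. J l m n = 0"
    proof (rule descent_two_directions[where I = L and J = N and P = "\<lambda>l n. \<forall>m. J l m n = 0"])
      show "\<forall>m. J l m n = 0" if "L \<le> l" for l n
        using bounds(1) that by blast
      show "\<forall>m. J l m n = 0" if "N \<le> n" for l n
        using bounds(2) that by blast
      show "\<forall>m. J l m n = 0" if "\<forall>m. J (l + 1) m n = 0" "\<forall>m. J l m (n + 1) = 0" for l n
      proof
        fix m
        show "J l m n = 0" using that rec[of l "m - 1" n] by simp
      qed
    qed
    then show "J l m n = 0" by blast }
  { assume "\<forall>l m n. M \<le> m \<longrightarrow> J l m n = 0" "\<forall>l m n. N \<le> n \<longrightarrow> J l m n = 0"
    note bounds = this
    have "\<forall>l. J l m n = 0"
    proof (rule descent_two_directions[where I = M and J = N and P = "\<lambda>m n. \<forall>l. J l m n = 0"])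
      show "\<forall>l. J l m n = 0" if "M \<le> m" for m n
        using bounds(1) that by blast
      show "\<forall>l. J l m n = 0" if "N \<le> n" for m n
        using bounds(2) that by blast
      show "\<forall>l. J l m n = 0" if "\<forall>l. J l (m + 1) n = 0" "\<forall>l. J l m (n + 1) = 0" for m n
      proof
        fix l
        show "J l m n = 0" using that rec[of "l - 1" m n] by simp
      qed
    qed
    then show "J l m n = 0" by blast }
qed

text \<open>
  On series, raising the index \<open>l\<close> is multiplication by \<open>x\<^sub>1 - x\<^sub>2\<close>, raising \<open>m\<close> is
  multiplication by \<open>x\<^sub>0 + x\<^sub>2\<close>, and raising \<open>n\<close> is multiplication by \<open>x\<^sub>1 - x\<^sub>0\<close>.  So the powers in the three
  weak properties move the slice at \<open>0\<close> to the slice at the exponent.  The variables are listed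
  in the order used by the respective property, which for the third index is \<open>(x\<^sub>1, x\<^sub>0)\<close>.
\<close>

lemma three_term_raise_first:
  assumes "vector_space scale" and "three_term J"
  shows "series_mult scale (binom_power 1 (- 1) (int k)) (\<lambda>(a, b). J 0 (- a - 1) (- b - 1))
    = (\<lambda>(a, b). J (int k) (- a - 1) (- b - 1))"
proof -
  interpret vector_space scale by fact
  define H where "H = (\<lambda>k (a, b). J (int k) (- a - 1) (- b - 1))"
  have "series_mult scale (binom_power 1 (- 1) (int k)) (H 0) = H k"
  proof (rule series_mult_binom_power_iterate[OF assms(1), where H = H])
    show "H (Suc k) (a, b) = scale 1 (H k (a - 1, b)) + scale (- 1) (H k (a, b - 1))" for k a b
      using assms(2)[unfolded three_term_def, rule_format, of "int k" "- a - 1" "- b - 1"]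
      by (simp add: H_def algebra_simps)
  qed simp_all
  then show ?thesis by (simp add: H_def)
qed

lemma three_term_raise_second:
  assumes "vector_space scale" and "three_term J"
  shows "series_mult scale (binom_power 1 1 (int k)) (\<lambda>(a, b). J (- a - 1) 0 (- b - 1))
    = (\<lambda>(a, b). J (- a - 1) (int k) (- b - 1))"
proof -
  interpret vector_space scale by fact
  define H where "H = (\<lambda>k (a, b). J (- a - 1) (int k) (- b - 1))"
  have "series_mult scale (binom_power 1 1 (int k)) (H 0) = H k"
  proof (rule series_mult_binom_power_iterate[OF assms(1), where H = H])
    show "H (Suc k) (a, b) = scale 1 (H k (a - 1, b)) + scale 1 (H k (a, b - 1))" for k a b
      using assms(2)[unfolded three_term_def, rule_format, of "- a - 1" "int k" "- b - 1"]
      by (simp add: H_def algebra_simps)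
  qed simp_all
  then show ?thesis by (simp add: H_def)
qed

lemma three_term_raise_third:
  assumes "vector_space scale" and "three_term J"
  shows "series_mult scale (binom_power 1 (- 1) (int k)) (\<lambda>(a, b). J (- b - 1) (- a - 1) 0)
    = (\<lambda>(a, b). J (- b - 1) (- a - 1) (int k))"
proof -
  interpret vector_space scale by fact
  define H where "H = (\<lambda>k (a, b). J (- b - 1) (- a - 1) (int k))"
  have "series_mult scale (binom_power 1 (- 1) (int k)) (H 0) = H k"
  proof (rule series_mult_binom_power_iterate[OF assms(1), where H = H])
    show "H (Suc k) (a, b) = scale 1 (H k (a - 1, b)) + scale (- 1) (H k (a, b - 1))" for k a b
      using assms(2)[unfolded three_term_def, rule_format, of "- b - 1" "- a - 1" "int k"]
      by (simp add: H_def algebra_simps)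
  qed simp_all
  then show ?thesis by (simp add: H_def)
qed

section \<open>The three terms of Borcherds' identity\<close>

locale vertex_operator_map_pair =
  VV: vertex_operator_map scaleV scaleV Y + vertex_operator_map scaleV scaleW YW
  for scaleV :: "complex \<Rightarrow> 'v \<Rightarrow> 'v::ab_group_add"
    and scaleW :: "complex \<Rightarrow> 'w \<Rightarrow> 'w::ab_group_add"
    and Y :: "'v \<Rightarrow> int \<Rightarrow> 'v \<Rightarrow> 'v"
    and YW :: "'v \<Rightarrow> int \<Rightarrow> 'w \<Rightarrow> 'w"
begin

text \<open>
  The next three functions are the terms of Borcherds' identity, and \<open>jacobi_defect\<close> is the amount by
  which that identity fails.
\<close>

definition product_comp :: "'v \<Rightarrow> 'v \<Rightarrow> 'w \<Rightarrow> int \<Rightarrow> int \<Rightarrow> int \<Rightarrow> 'w" where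
  "product_comp u v w l m n =
     binom_sum scaleW l (\<lambda>k. scaleW ((- 1) ^ k) (YW u (l + m - int k) (YW v (n + int k) w)))"

definition opposite_comp :: "'v \<Rightarrow> 'v \<Rightarrow> 'w \<Rightarrow> int \<Rightarrow> int \<Rightarrow> int \<Rightarrow> 'w" where
  "opposite_comp u v w l m n =
     binom_sum scaleW l (\<lambda>k. scaleW ((- 1) powi (l - int k)) (YW v (n + l - int k) (YW u (m + int k) w)))"

definition iterate_comp :: "'v \<Rightarrow> 'v \<Rightarrow> 'w \<Rightarrow> int \<Rightarrow> int \<Rightarrow> int \<Rightarrow> 'w" where
  "iterate_comp u v w l m n =
     binom_sum scaleW m (\<lambda>k. YW (Y u (l + int k) v) (m + n - int k) w)"

definition jacobi_defect :: "'v \<Rightarrow> 'v \<Rightarrow> 'w \<Rightarrow> int \<Rightarrow> int \<Rightarrow> int \<Rightarrow> 'w" where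
  "jacobi_defect u v w l m n = product_comp u v w l m n - opposite_comp u v w l m n - iterate_comp u v w l m n"

lemma mode_zero_left [simp]: "YW 0 n w = 0"
  using module_hom.zero[of scaleV scaleW "\<lambda>v. YW v n w"] linear_map[of n w]
  by (simp add: linear_iff_module_hom)

lemma mode_zero_right [simp]: "YW v n 0 = 0"
  using module_hom.zero[of scaleW scaleW "YW v n"] linear_mode[of v n]
  by (simp add: linear_iff_module_hom)

lemmas vsW = W.vector_space_axioms

text \<open>
  Each of the three terms vanishes once the index is large that shifts the innermost mode of that term.
  The bound for the iterate does not involve \<open>w\<close>, which is what makes the exponent in weak
  commutativity uniform in \<open>w\<close>.
\<close>

lemma product_comp_above: "\<exists>N. \<forall>l m n. N \<le> n \<longrightarrow> product_comp u v w l m n = 0"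
proof -
  obtain N where "\<And>n. N \<le> n \<Longrightarrow> YW v n w = 0" using truncation by blast
  then have "N \<le> n \<longrightarrow> product_comp u v w l m n = 0" for l m n
    unfolding product_comp_def by (auto intro!: binom_sum_eq_0[OF vsW])
  then show ?thesis by blast
qed

lemma opposite_comp_above: "\<exists>M. \<forall>l m n. M \<le> m \<longrightarrow> opposite_comp u v w l m n = 0"
proof -
  obtain N where "\<And>n. N \<le> n \<Longrightarrow> YW u n w = 0" using truncation by blast
  then have "N \<le> m \<longrightarrow> opposite_comp u v w l m n = 0" for l m n
    unfolding opposite_comp_def by (auto intro!: binom_sum_eq_0[OF vsW])
  then show ?thesis by blast
qed

lemma iterate_comp_above: "\<exists>L. \<forall>w l m n. L \<le> l \<longrightarrow> iterate_comp u v w l m n = 0"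
proof -
  obtain N where "\<And>n. N \<le> n \<Longrightarrow> Y u n v = 0" using VV.truncation by blast
  then have "N \<le> l \<longrightarrow> iterate_comp u v w l m n = 0" for w l m n
    unfolding iterate_comp_def by (auto intro!: binom_sum_eq_0[OF vsW])
  then show ?thesis by blast
qed

text \<open>
  This brings the truncation condition into the form required by the summed Pascal rule.
\<close>

lemma truncated_shift:
  assumes "\<forall>n\<ge>N. f n = (0 :: 'c::zero)"
  shows "\<forall>k\<ge>nat (N - n). f (n + int k) = 0"
  using assms by auto

text \<open>
  Pascal's rule is applied in the upper index of the binomial coefficients, which is \<open>l\<close> here and for the
  opposite term, and \<open>m\<close> for the iterate.
\<close>

lemma three_term_product_comp: "three_term (product_comp u v w)"
  unfolding three_term_def
proof (intro allI)
  fix l m n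
  obtain N where "\<forall>n\<ge>N. YW v n w = 0" using truncation by blast
  note N = truncated_shift[OF this, of n]
  let ?F = "\<lambda>k. scaleW ((- 1) ^ k) (YW u (l + 1 + m - int k) (YW v (n + int k) w))"
  have "product_comp u v w (l + 1) m n = binom_sum scaleW l ?F + binom_sum scaleW l (\<lambda>k. ?F (Suc k))"
    unfolding product_comp_def
    by (rule binom_sum_plus_one[OF vsW]) (use N in auto)
  also have "(\<lambda>k. ?F (Suc k)) = (\<lambda>k. scaleW (- 1)
       (scaleW ((- 1) ^ k) (YW u (l + m - int k) (YW v (n + 1 + int k) w))))"
    by (simp add: algebra_simps)
  also have "binom_sum scaleW l \<dots> = - product_comp u v w l m (n + 1)"
    unfolding product_comp_def by (subst binom_sum_scale[OF vsW]) simp_all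
  also have "binom_sum scaleW l ?F = product_comp u v w l (m + 1) n"
    unfolding product_comp_def by (simp add: algebra_simps)
  finally show "product_comp u v w l (m + 1) n = product_comp u v w (l + 1) m n + product_comp u v w l m (n + 1)"
    by simp
qed

lemma three_term_opposite_comp: "three_term (opposite_comp u v w)"
  unfolding three_term_def
proof (intro allI)
  fix l m n
  obtain N where "\<forall>n\<ge>N. YW u n w = 0" using truncation by blast
  note N = truncated_shift[OF this, of m]
  let ?F = "\<lambda>k. scaleW ((- 1) powi (l + 1 - int k)) (YW v (n + (l + 1) - int k) (YW u (m + int k) w))"
  have "opposite_comp u v w (l + 1) m n = binom_sum scaleW l ?F + binom_sum scaleW l (\<lambda>k. ?F (Suc k))"
    unfolding opposite_comp_def
    by (rule binom_sum_plus_one[OF vsW]) (use N in auto)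
  also have "(\<lambda>k. ?F (Suc k)) = (\<lambda>k. scaleW ((- 1) powi (l - int k)) (YW v (n + l - int k) (YW u (m + 1 + int k) w)))"
    by (simp add: algebra_simps)
  also have "binom_sum scaleW l \<dots> = opposite_comp u v w l (m + 1) n"
    unfolding opposite_comp_def ..
  also have "?F = (\<lambda>k. scaleW (- 1) (scaleW ((- 1) powi (l - int k)) (YW v (n + 1 + l - int k) (YW u (m + int k) w))))"
  proof
    fix k
    have "(- 1 :: complex) powi (l + 1 - int k) = - ((- 1) powi (l - int k))"
      using power_int_add[of "- 1 :: complex" "l - int k" 1] by (simp add: algebra_simps)
    then show "?F k = scaleW (- 1) (scaleW ((- 1) powi (l - int k)) (YW v (n + 1 + l - int k) (YW u (m + int k) w)))"
      by (simp add: algebra_simps)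
  qed
  also have "binom_sum scaleW l \<dots> = - opposite_comp u v w l m (n + 1)"
    unfolding opposite_comp_def by (subst binom_sum_scale[OF vsW]) simp_all
  finally show "opposite_comp u v w l (m + 1) n = opposite_comp u v w (l + 1) m n + opposite_comp u v w l m (n + 1)"
    by simp
qed

lemma three_term_iterate_comp: "three_term (iterate_comp u v w)"
  unfolding three_term_def
proof (intro allI)
  fix l m n
  obtain N where "\<forall>n\<ge>N. Y u n v = 0" using VV.truncation by blast
  note N = truncated_shift[OF this, of l]
  let ?F = "\<lambda>k. YW (Y u (l + int k) v) (m + 1 + n - int k) w"
  have "iterate_comp u v w l (m + 1) n = binom_sum scaleW m ?F + binom_sum scaleW m (\<lambda>k. ?F (Suc k))"
    unfolding iterate_comp_def
    by (rule binom_sum_plus_one[OF vsW]) (use N in auto)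
  then show "iterate_comp u v w l (m + 1) n = iterate_comp u v w (l + 1) m n + iterate_comp u v w l m (n + 1)"
    unfolding iterate_comp_def by (simp add: algebra_simps)
qed

lemmas three_term_comps = three_term_product_comp three_term_opposite_comp three_term_iterate_comp

lemma three_term_jacobi_defect: "three_term (jacobi_defect u v w)"
  using three_term_comps[of u v w] by (simp add: three_term_def jacobi_defect_def)

section \<open>The series identities in terms of modes\<close>

text \<open>
  Multiplying by a delta function collapses the sum over exponent triples to a sum over one
  nonnegative integer \<open>k\<close>, the exponent of the second-listed variable of the binomial; \<open>h\<close>
  lists the triples that contribute.
\<close>

lemma series_mult_single_index:
  assumes "inj h" "\<And>x. x \<notin> range h \<Longrightarrow> scaleW (f x) (F (e - x)) = 0"
    and "\<And>k. scaleW (f (h k)) (F (e - h k)) = scaleW (of_int n gchoose k) (G k)"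
  shows "series_mult scaleW f F e = binom_sum scaleW n G"
  unfolding series_mult_def binom_sum_def
  by (subst Sum_any_reindex_inj[OF assms(1,2)]) (simp_all add: assms(3))

lemma jacobi_product_term:
  "series_mult scaleW (\<lambda>(a0, a1, a2). delta_quot 1 (- 1) (a0, a1, a2))
     (\<lambda>(a0, a1, a2). if a0 = 0 then vo_product YW u v w (a1, a2) else 0) (e0, e1, e2)
   = product_comp u v w (- e0 - 1) (- e1 - 1) (- e2 - 1)"
  unfolding product_comp_def
proof (rule series_mult_single_index[where h = "\<lambda>k. (e0, - e0 - 1 - int k, int k)"], goal_cases)
  case 1
  show ?case by (auto intro: injI)
next
  case (2 x)
  obtain i j k where x: "x = (i, j, k)" by (cases x)
  have "\<not> (i = e0 \<and> 0 \<le> k \<and> j + k = - e0 - 1)"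
    using 2 by (auto simp: x image_iff dest: spec[of _ "nat k"])
  then show ?case by (auto simp: x delta_quot_def binom_power_def)
next
  case (3 k)
  then show ?case
    by (simp add: delta_quot_def binom_power_def vo_product_def algebra_simps)
qed

lemma jacobi_opposite_term:
  "series_mult scaleW (\<lambda>(a0, a1, a2). delta_quot (- 1) 1 (a0, a2, a1))
     (\<lambda>(a0, a1, a2). if a0 = 0 then vo_product YW v u w (a2, a1) else 0) (e0, e1, e2)
   = opposite_comp u v w (- e0 - 1) (- e1 - 1) (- e2 - 1)"
  unfolding opposite_comp_def
proof (rule series_mult_single_index[where h = "\<lambda>k. (e0, int k, - e0 - 1 - int k)"], goal_cases)
  case 1
  show ?case by (auto intro: injI)
next
  case (2 x)
  obtain i j k where x: "x = (i, j, k)" by (cases x)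
  have "\<not> (i = e0 \<and> 0 \<le> j \<and> k + j = - e0 - 1)"
    using 2 by (auto simp: x image_iff dest: spec[of _ "nat j"])
  then show ?case by (auto simp: x delta_quot_def binom_power_def)
next
  case (3 k)
  then show ?case
    by (simp add: delta_quot_def binom_power_def vo_product_def algebra_simps)
qed

lemma jacobi_iterate_term:
  "series_mult scaleW (\<lambda>(a0, a1, a2). delta_quot 1 1 (a1, a2, a0))
     (\<lambda>(a0, a1, a2). if a1 = 0 then vo_iterate Y YW u v w (a0, a2) else 0) (e0, e1, e2)
   = iterate_comp u v w (- e0 - 1) (- e1 - 1) (- e2 - 1)"
  unfolding iterate_comp_def
proof (rule series_mult_single_index[where h = "\<lambda>k. (int k, e1, - e1 - 1 - int k)"], goal_cases)
  case 1
  show ?case by (auto intro: injI)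
next
  case (2 x)
  obtain i j k where x: "x = (i, j, k)" by (cases x)
  have "\<not> (j = e1 \<and> 0 \<le> i \<and> k + i = - e1 - 1)"
    using 2 by (auto simp: x image_iff dest: spec[of _ "nat i"])
  then show ?case by (auto simp: x delta_quot_def binom_power_def)
next
  case (3 k)
  then show ?case
    by (simp add: delta_quot_def binom_power_def vo_iterate_def algebra_simps)
qed

text \<open>
  An exponent \<open>a\<close> corresponds to the mode \<open>- a - 1\<close>, and this correspondence is bijective.
\<close>

lemma all_mode_iff: "(\<forall>a. P (- a - 1)) \<longleftrightarrow> (\<forall>n :: int. P n)"
proof
  assume P: "\<forall>a. P (- a - 1)"
  show "\<forall>n. P n"
  proof
    fix n
    show "P n" using P[rule_format, of "- n - 1"] by simp
  qed
qed blast

lemma jacobi_identity_iff: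
  "jacobi_identity scaleW Y YW \<longleftrightarrow> (\<forall>u v w l m n. jacobi_defect u v w l m n = 0)"
proof -
  have "jacobi_identity scaleW Y YW \<longleftrightarrow>
    (\<forall>u v w a b c. jacobi_defect u v w (- a - 1) (- b - 1) (- c - 1) = 0)"
    by (simp only: jacobi_identity_def split_paired_All jacobi_product_term jacobi_opposite_term
        jacobi_iterate_term jacobi_defect_def right_minus_eq)
  also have "\<dots> \<longleftrightarrow> (\<forall>u v w l m n. jacobi_defect u v w l m n = 0)"
    by (subst (1 2 3) all_mode_iff) (rule refl)
  finally show ?thesis .
qed

text \<open>
  The series obtained by substitution in weak associativity and weak skew-associativity are the
  slices at \<open>m = 0\<close> and \<open>n = 0\<close>.  The substitution \<open>- x\<^sub>0 + x\<^sub>1\<close> produces \<open>- B\<close>, the sign that \<open>B\<close> has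
  in the Jacobi identity.
\<close>

lemma product_subst:
  "series_subst scaleW 1 1 (vo_product YW u v w) (a0, a2) = product_comp u v w (- a0 - 1) 0 (- a2 - 1)"
  by (simp add: series_subst_binom_sum[OF vsW] product_comp_def vo_product_def algebra_simps)

lemma opposite_subst:
  "series_subst scaleW (- 1) 1 (vo_product YW v u w) (a0, a1) = - opposite_comp u v w (- a0 - 1) (- a1 - 1) 0"
proof -
  have sgn: "(- 1 :: complex) powi a0 * (- 1) ^ k = - ((- 1) powi (- a0 - 1 - int k))" for k
    by (cases "even a0"; cases "even k") (simp_all add: power_int_minus_left)
  have "series_subst scaleW (- 1) 1 (vo_product YW v u w) (a0, a1) =
    binom_sum scaleW (- a0 - 1) (\<lambda>k. scaleW (- 1) (scaleW ((- 1) powi (- a0 - 1 - int k)) 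
       (YW v (- a0 - 1 - int k) (YW u (- a1 - 1 + int k) w))))"
    by (simp add: series_subst_binom_sum[OF vsW] vo_product_def sgn algebra_simps)
  also have "\<dots> = - opposite_comp u v w (- a0 - 1) (- a1 - 1) 0"
    by (subst binom_sum_scale[OF vsW]) (simp_all add: opposite_comp_def)
  finally show ?thesis .
qed

lemma iterate_subst:
  "series_subst scaleW 1 (- 1) (\<lambda>(p, a). vo_iterate Y YW u v w (a, p)) (a1, a0)
     = iterate_comp u v w (- a0 - 1) (- a1 - 1) 0"
  by (simp add: series_subst_binom_sum[OF vsW] iterate_comp_def vo_iterate_def algebra_simps)

lemma product_comp_0: "product_comp u v w 0 m n = YW u m (YW v n w)"
  by (simp add: product_comp_def binom_sum_0[OF vsW])

lemma opposite_comp_0: "opposite_comp u v w 0 m n = YW v n (YW u m w)"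
  by (simp add: opposite_comp_def binom_sum_0[OF vsW])

lemma iterate_comp_0: "iterate_comp u v w l 0 n = YW (Y u l v) n w"
  by (simp add: iterate_comp_def binom_sum_0[OF vsW])

lemma weak_commutativity_iff:
  "weak_commutativity scaleW YW \<longleftrightarrow>
     (\<forall>u v. \<exists>L::nat. \<forall>w m n. product_comp u v w (int L) m n - opposite_comp u v w (int L) m n = 0)"
  (is "_ \<longleftrightarrow> ?rhs")
proof -
  have "series_mult scaleW (binom_power 1 (- 1) (int k))
      (\<lambda>(a1, a2). vo_product YW u v w (a1, a2) - vo_product YW v u w (a2, a1)) =
    (\<lambda>(a1, a2). product_comp u v w (int k) (- a1 - 1) (- a2 - 1)
       - opposite_comp u v w (int k) (- a1 - 1) (- a2 - 1))" for u v w k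
    using three_term_raise_first[OF vsW three_term_diff[OF three_term_comps(1,2)], of k u v w u v w]
    by (simp add: product_comp_0 opposite_comp_0 vo_product_def)
  then have "weak_commutativity scaleW YW \<longleftrightarrow>
     (\<forall>u v. \<exists>L::nat. \<forall>w a b. product_comp u v w (int L) (- a - 1) (- b - 1) - opposite_comp u v w (int L) (- a - 1) (- b - 1) = 0)"
    by (simp add: weak_commutativity_def split_paired_All)
  also have "\<dots> \<longleftrightarrow> ?rhs"
    by (subst (1 2) all_mode_iff) (rule refl)
  finally show ?thesis .
qed

lemma weak_associativity_iff:
  "weak_associativity scaleW Y YW \<longleftrightarrow>
     (\<forall>u v w. \<exists>M::nat. \<forall>l n. product_comp u v w l (int M) n - iterate_comp u v w l (int M) n = 0)"
  (is "_ \<longleftrightarrow> ?rhs")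
proof -
  have "series_mult scaleW (binom_power 1 1 (int k))
      (\<lambda>(a0, a2). series_subst scaleW 1 1 (vo_product YW u v w) (a0, a2) - vo_iterate Y YW u v w (a0, a2)) =
    (\<lambda>(a0, a2). product_comp u v w (- a0 - 1) (int k) (- a2 - 1)
       - iterate_comp u v w (- a0 - 1) (int k) (- a2 - 1))" for u v w k
    using three_term_raise_second[OF vsW three_term_diff[OF three_term_comps(1,3)], of k u v w u v w]
    by (simp add: product_subst iterate_comp_0 vo_iterate_def)
  then have "weak_associativity scaleW Y YW \<longleftrightarrow>
     (\<forall>u v w. \<exists>M::nat. \<forall>a b. product_comp u v w (- a - 1) (int M) (- b - 1) - iterate_comp u v w (- a - 1) (int M) (- b - 1) = 0)"
    by (simp add: weak_associativity_def split_paired_All)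
  also have "\<dots> \<longleftrightarrow> ?rhs"
    by (subst (1 2) all_mode_iff) (rule refl)
  finally show ?thesis .
qed

lemma weak_skew_associativity_iff:
  "weak_skew_associativity scaleW Y YW \<longleftrightarrow>
     (\<forall>u v w. \<exists>N::nat. \<forall>l m. - opposite_comp u v w l m (int N) - iterate_comp u v w l m (int N) = 0)"
  (is "_ \<longleftrightarrow> ?rhs")
proof -
  have "series_mult scaleW (binom_power 1 (- 1) (int k))
      (\<lambda>(a1, a0). series_subst scaleW (- 1) 1 (vo_product YW v u w) (a0, a1)
         - series_subst scaleW 1 (- 1) (\<lambda>(p, a). vo_iterate Y YW u v w (a, p)) (a1, a0)) =
    (\<lambda>(a1, a0). - opposite_comp u v w (- a0 - 1) (- a1 - 1) (int k)
       - iterate_comp u v w (- a0 - 1) (- a1 - 1) (int k))" for u v w k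
    using three_term_raise_third[OF vsW three_term_diff[OF three_term_uminus[OF three_term_comps(2)] three_term_comps(3)], of k u v w u v w]
    by (simp add: opposite_subst iterate_subst)
  then have "weak_skew_associativity scaleW Y YW \<longleftrightarrow>
     (\<forall>u v w. \<exists>N::nat. \<forall>b a. - opposite_comp u v w (- a - 1) (- b - 1) (int N) - iterate_comp u v w (- a - 1) (- b - 1) (int N) = 0)"
    by (simp add: weak_skew_associativity_def split_paired_All)
  also have "\<dots> \<longleftrightarrow> ?rhs"
    by (subst (1 2) all_mode_iff) blast
  finally show ?thesis .
qed

section \<open>The weak properties as vanishing of the defect\<close>

text \<open>
  Forwards: if \<open>A - B\<close> vanishes at one \<open>l\<close>, it does so at all larger ones, and eventually \<open>C\<close> is gone
  too.  Backwards: where \<open>J\<close> and \<open>C\<close> both vanish, so does \<open>A - B\<close>.  The other two properties follow the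
  same pattern, with \<open>B\<close> and \<open>A\<close> in the place of \<open>C\<close>.
\<close>

lemma weak_commutativity_iff_defect:
  "weak_commutativity scaleW YW \<longleftrightarrow>
     (\<forall>u v. \<exists>L. \<forall>w l m n. L \<le> l \<longrightarrow> jacobi_defect u v w l m n = 0)"
proof -
  have "(\<exists>L::nat. \<forall>w m n. product_comp u v w (int L) m n - opposite_comp u v w (int L) m n = 0)
     \<longleftrightarrow> (\<exists>L. \<forall>w l m n. L \<le> l \<longrightarrow> jacobi_defect u v w l m n = 0)" (is "?l \<longleftrightarrow> ?r") for u v
  proof -
    obtain L0 where L0: "\<And>w l m n. L0 \<le> l \<Longrightarrow> iterate_comp u v w l m n = 0"
      using iterate_comp_above by metis
    show ?thesis
    proof
      assume ?l
      then obtain L where L: "product_comp u v w (int L) m n - opposite_comp u v w (int L) m n = 0" for w m n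
        by blast
      have "jacobi_defect u v w l m n = 0" if "max L0 (int L) \<le> l" for w l m n
        using three_term_above(1)[OF three_term_diff[OF three_term_comps(1,2)[of u v w]] L, of l m n] L0[of l w m n] that
        by (simp add: jacobi_defect_def)
      then show ?r by blast
    next
      assume ?r
      then obtain L where L: "\<And>w l m n. L \<le> l \<Longrightarrow> jacobi_defect u v w l m n = 0"
        by blast
      obtain K :: nat where "L \<le> int K" "L0 \<le> int K"
        by (rule that[of "nat (max L L0)"]) linarith+
      then show ?l
        using L[of "int K"] L0[of "int K"] by (intro exI[of _ K]) (simp add: jacobi_defect_def)
    qed
  qed
  then show ?thesis
    unfolding weak_commutativity_iff by simp
qed

lemma weak_associativity_iff_defect:
  "weak_associativity scaleW Y YW \<longleftrightarrow>
     (\<forall>u v w. \<exists>M. \<forall>l m n. M \<le> m \<longrightarrow> jacobi_defect u v w l m n = 0)"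
proof -
  have "(\<exists>M::nat. \<forall>l n. product_comp u v w l (int M) n - iterate_comp u v w l (int M) n = 0)
     \<longleftrightarrow> (\<exists>M. \<forall>l m n. M \<le> m \<longrightarrow> jacobi_defect u v w l m n = 0)" (is "?l \<longleftrightarrow> ?r") for u v w
  proof -
    obtain M0 where M0: "\<And>l m n. M0 \<le> m \<Longrightarrow> opposite_comp u v w l m n = 0"
      using opposite_comp_above by metis
    show ?thesis
    proof
      assume ?l
      then obtain M where M: "product_comp u v w l (int M) n - iterate_comp u v w l (int M) n = 0" for l n
        by blast
      have "jacobi_defect u v w l m n = 0" if "max M0 (int M) \<le> m" for l m n
        using three_term_above(2)[OF three_term_diff[OF three_term_comps(1,3)] M, of m l n] M0[of m] that
        by (simp add: jacobi_defect_def)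
      then show ?r by blast
    next
      assume ?r
      then obtain M where M: "\<And>l m n. M \<le> m \<Longrightarrow> jacobi_defect u v w l m n = 0"
        by blast
      obtain K :: nat where "M \<le> int K" "M0 \<le> int K"
        by (rule that[of "nat (max M M0)"]) linarith+
      then show ?l
        using M[of "int K"] M0[of "int K"] by (intro exI[of _ K]) (simp add: jacobi_defect_def)
    qed
  qed
  then show ?thesis
    unfolding weak_associativity_iff by simp
qed

lemma weak_skew_associativity_iff_defect:
  "weak_skew_associativity scaleW Y YW \<longleftrightarrow>
     (\<forall>u v w. \<exists>N. \<forall>l m n. N \<le> n \<longrightarrow> jacobi_defect u v w l m n = 0)"
proof -
  have "(\<exists>N::nat. \<forall>l m. - opposite_comp u v w l m (int N) - iterate_comp u v w l m (int N) = 0)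
     \<longleftrightarrow> (\<exists>N. \<forall>l m n. N \<le> n \<longrightarrow> jacobi_defect u v w l m n = 0)" (is "?l \<longleftrightarrow> ?r") for u v w
  proof -
    obtain N0 where N0: "\<And>l m n. N0 \<le> n \<Longrightarrow> product_comp u v w l m n = 0"
      using product_comp_above by metis
    show ?thesis
    proof
      assume ?l
      then obtain N where N: "- opposite_comp u v w l m (int N) - iterate_comp u v w l m (int N) = 0" for l m
        by blast
      have "jacobi_defect u v w l m n = 0" if "max N0 (int N) \<le> n" for l m n
        using three_term_above(3)[OF three_term_diff[OF three_term_uminus[OF three_term_comps(2)] three_term_comps(3)] N,
            of n l m] N0[of n] that
        by (simp add: jacobi_defect_def)
      then show ?r by blast
    next
      assume ?r
      then obtain N where N: "\<And>l m n. N \<le> n \<Longrightarrow> jacobi_defect u v w l m n = 0"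
        by blast
      obtain K :: nat where "N \<le> int K" "N0 \<le> int K"
        by (rule that[of "nat (max N N0)"]) linarith+
      then show ?l
        using N[of "int K"] N0[of "int K"] by (intro exI[of _ K]) (simp add: jacobi_defect_def)
    qed
  qed
  then show ?thesis
    unfolding weak_skew_associativity_iff by simp
qed

lemma weak_axiom_pairs_iff_jacobi:
  "weak_commutativity scaleW YW \<and> weak_associativity scaleW Y YW
     \<longleftrightarrow> jacobi_identity scaleW Y YW"
  "weak_commutativity scaleW YW \<and> weak_skew_associativity scaleW Y YW
     \<longleftrightarrow> jacobi_identity scaleW Y YW"
  "weak_associativity scaleW Y YW \<and> weak_skew_associativity scaleW Y YW
     \<longleftrightarrow> jacobi_identity scaleW Y YW"
proof -
  have comm: "\<exists>L. \<forall>l m n. L \<le> l \<longrightarrow> jacobi_defect u v w l m n = 0" if "weak_commutativity scaleW YW" for u v w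
    using that unfolding weak_commutativity_iff_defect by blast
  have assoc: "\<exists>M. \<forall>l m n. M \<le> m \<longrightarrow> jacobi_defect u v w l m n = 0" if "weak_associativity scaleW Y YW" for u v w
    using that unfolding weak_associativity_iff_defect by blast
  have skew: "\<exists>N. \<forall>l m n. N \<le> n \<longrightarrow> jacobi_defect u v w l m n = 0" if "weak_skew_associativity scaleW Y YW" for u v w
    using that unfolding weak_skew_associativity_iff_defect by blast
  have weak: "weak_commutativity scaleW YW" "weak_associativity scaleW Y YW" "weak_skew_associativity scaleW Y YW"
    if "jacobi_identity scaleW Y YW"
    using that unfolding jacobi_identity_iff weak_commutativity_iff_defect weak_associativity_iff_defect
      weak_skew_associativity_iff_defect by simp_all
  have "jacobi_identity scaleW Y YW" if "weak_commutativity scaleW YW" "weak_associativity scaleW Y YW"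
    unfolding jacobi_identity_iff
  proof (intro allI)
    fix u v w l m n
    from comm[OF that(1), of u v w] assoc[OF that(2), of u v w] show "jacobi_defect u v w l m n = 0"
      by (elim exE) (rule three_term_vanishes(1)[OF three_term_jacobi_defect])
  qed
  with weak(1,2) show "weak_commutativity scaleW YW \<and> weak_associativity scaleW Y YW
     \<longleftrightarrow> jacobi_identity scaleW Y YW"
    by (intro iffI conjI) simp_all
  have "jacobi_identity scaleW Y YW" if "weak_commutativity scaleW YW" "weak_skew_associativity scaleW Y YW"
    unfolding jacobi_identity_iff
  proof (intro allI)
    fix u v w l m n
    from comm[OF that(1), of u v w] skew[OF that(2), of u v w] show "jacobi_defect u v w l m n = 0"
      by (elim exE) (rule three_term_vanishes(2)[OF three_term_jacobi_defect])
  qed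
  with weak(1,3) show "weak_commutativity scaleW YW \<and> weak_skew_associativity scaleW Y YW
     \<longleftrightarrow> jacobi_identity scaleW Y YW"
    by (intro iffI conjI) simp_all
  have "jacobi_identity scaleW Y YW" if "weak_associativity scaleW Y YW" "weak_skew_associativity scaleW Y YW"
    unfolding jacobi_identity_iff
  proof (intro allI)
    fix u v w l m n
    from assoc[OF that(1), of u v w] skew[OF that(2), of u v w] show "jacobi_defect u v w l m n = 0"
      by (elim exE) (rule three_term_vanishes(3)[OF three_term_jacobi_defect])
  qed
  with weak(2,3) show "weak_associativity scaleW Y YW \<and> weak_skew_associativity scaleW Y YW
     \<longleftrightarrow> jacobi_identity scaleW Y YW"
    by (intro iffI conjI) simp_all
qed

end

section \<open>Any two weak axioms are equivalent to the Jacobi identity\<close>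

theorem proposition5p2:
  fixes scaleV :: "complex \<Rightarrow> 'v \<Rightarrow> 'v::ab_group_add"
    and scaleW :: "complex \<Rightarrow> 'w \<Rightarrow> 'w::ab_group_add"
    and Y :: "'v \<Rightarrow> int \<Rightarrow> 'v \<Rightarrow> 'v"
    and YW :: "'v \<Rightarrow> int \<Rightarrow> 'w \<Rightarrow> 'w"
  assumes "vacuum_free_vertex_algebra scaleV Y"
    and "vertex_operator_map scaleV scaleW YW"
  shows "(weak_commutativity scaleW YW \<and> weak_associativity scaleW Y YW
            \<longleftrightarrow> jacobi_identity scaleW Y YW)
       \<and> (weak_commutativity scaleW YW \<and> weak_skew_associativity scaleW Y YW
            \<longleftrightarrow> jacobi_identity scaleW Y YW)
       \<and> (weak_associativity scaleW Y YW \<and> weak_skew_associativity scaleW Y YW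
            \<longleftrightarrow> jacobi_identity scaleW Y YW)"
proof -
  interpret vacuum_free_vertex_algebra scaleV Y by fact
  interpret vertex_operator_map_pair scaleV scaleW Y YW
    using assms(2) vertex_operator_map_axioms by (simp add: vertex_operator_map_pair_def)
  show ?thesis
    using weak_axiom_pairs_iff_jacobi by blast
qed

end
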